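(* The matrix elements of the operators $K_i(z)$ with respect to the vectors $v_{i_1,\dots,i_k}$ are given by the $(2k+1)$-st derivatives of the function $$\tilde P(z_1,\dots,z_n)=\frac{c^2}{(2k)!}\sum_{1\le i_1<\dots<i_{k+1}\le n}\frac{\prod_{\ell=1}^{k+1}a_{i_\ell}}{\prod_{\ell=1}^{k+1}d^2_{i_1,\dots,\widehat{i_\ell},\dots,i_{k+1}}}\,f_{i_1,\dots,i_{k+1}}^{2k}\log f_{i_1,\dots,i_{k+1}} .$$ Precisely: for any $m_0,m_1,\dots,m_{2k}\in J$ such that $m_1,\dots,m_k$ are distinct and $m_{k+1},\dots,m_{2k}$ are distinct, and any $z\in\mathbb C^n-\Delta$, $$c^2\,S^{(a)}\big(K_{m_0}(z)v_{m_1,\dots,m_k},\,v_{m_{k+1},\dots,m_{2k}}\big)=d_{m_1,\dots,m_k}\,d_{m_{k+1},\dots,m_{2k}}\,\frac{\partial^{2k+1}\tilde P}{\partial z_{m_0}\cdots\partial z_{m_{2k}}}(z).$$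
   Context: Let $1\le k<n$ be integers, $J=\{1,\dots,n\}$. Fix linear functions $g_j=\sum_{m=1}^k b_j^m t_m$ ($j\in J$) on $\mathbb C^k$ with $b^m_j\in\mathbb C$, and set $d_{i_1,\dots,i_k}=\det_{\ell,m=1}^k(b^m_{i_\ell})$; assume $d_{i_1,\dots,i_k}\neq0$ whenever $i_1,\dots,i_k$ are distinct. Put $f_j(z,t)=z_j+g_j(t)$ on $\mathbb C^n\times\mathbb C^k$, and for $i_1,\dots,i_{k+1}\in J$ put $f_{i_1,\dots,i_{k+1}}(z)=\sum_{m=1}^{k+1}(-1)^{m-1}z_{i_m}d_{i_1,\dots,\widehat{i_m},\dots,i_{k+1}}$. Let $\Delta\subset\mathbb C^n$ be the union of the hyperplanes $f_{i_1,\dots,i_{k+1}}=0$ over all $(k+1)$-element subsets of $J$. Fix weights $a_j\in\mathbb C\setminus\{0\}$ with $|a|:=\sum_{j\in J}a_j\ne0$. $V$ is the complex vector space with basis $F_{i_1,\dots,i_k}$, $1\le i_1<\dots<i_k\le n$; the symbol $F_{i_1,\dots,i_k}$ is extended to all indices by skew-symmetry (zero if an index repeats). $S^{(a)}$ is the symmetric bilinear form on $V$ for which this basis is orthogonal and $S^{(a)}(F_{i_1,\dots,i_k},F_{i_1,\dots,i_k})=\prod_m a_{i_m}$. $\operatorname{Sing}V\subset V$ is the subspace of vectors $\sum_{i_1<\dots<i_k}c_{i_1,\dots,i_k}F_{i_1,\dots,i_k}$ such that (extending $c$ skew-symmetrically) $\sum_{j\in J}a_jc_{j,j_1,\dots,j_{k-1}}=0$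 for all $\{j_1,\dots,j_{k-1}\}\subset J$. For distinct $i_1,\dots,i_k$ put $v_{i_1,\dots,i_k}=F_{i_1,\dots,i_k}-\sum_{m=1}^k\frac{a_{i_m}}{|a|}\sum_{j\in J}F_{i_1,\dots,i_{m-1},j,i_{m+1},\dots,i_k}\in\operatorname{Sing}V$. For a subset $\{i_1,\dots,i_{k+1}\}\subset J$ the operator $L_{i_1,\dots,i_{k+1}}:V\to V$ sends $F_{i_1,\dots,\widehat{i_m},\dots,i_{k+1}}\mapsto(-1)^m\sum_{\ell=1}^{k+1}(-1)^\ell a_{i_\ell}F_{i_1,\dots,\widehat{i_\ell},\dots,i_{k+1}}$ for $m=1,\dots,k+1$, and sends $F_{j_1,\dots,j_k}\mapsto0$ if $\{j_1,\dots,j_k\}\not\subset\{i_1,\dots,i_{k+1}\}$. For $i\in J$, $z\in\mathbb C^n-\Delta$, $K_i(z)=\sum\frac{d_{i_1,\dots,i_k}}{f_{i,i_1,\dots,i_k}(z)}L_{i,i_1,\dots,i_k}$, the sum over unordered $k$-element subsets $\{i_1,\dots,i_k\}\subset J-\{i\}$. (These operators preserve $\operatorname{Sing}V$ and are the operators of the Gauss-Manin connection $\kappa\,\partial I/\partial z_i=K_i(z)I$ for the associated hypergeometric integrals.) For $z\in\mathbb C^n-\Delta$ let $U(z)=\mathbb C^k-\bigcup_j\{t: f_j(z,t)=0\}$, $\Phi(z,t)=\sum_{j}a_j\log f_j(z,t)$, $\mathbb C(U(z))$ the algebra of rational functions on $\mathbb C^k$ regular on $U(z)$, and $A_\Phi(z)=\mathbb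 C(U(z))/\langle\partial\Phi/\partial t_1,\dots,\partial\Phi/\partial t_k\rangle$; $[g]$ is the class of $g$. The critical set of $\Phi(z,\cdot)$ on $U(z)$ is finite. The residue form is $([g],[h])_z=\sum_p\frac1{(2\pi\sqrt{-1})^k}\int_{\Gamma_p}\frac{gh\,dt_1\wedge\dots\wedge dt_k}{\prod_{i=1}^k\partial\Phi/\partial t_i}$, the sum over critical points $p$, where $\Gamma_p$ is the cycle $|\partial\Phi/\partial t_i|=\epsilon_i$ ($\epsilon_i$ small) near $p$, oriented by $d\arg\frac{\partial\Phi}{\partial t_1}\wedge\dots\wedge d\arg\frac{\partial\Phi}{\partial t_k}>0$ (sum of Grothendieck residues). The canonical isomorphism $\alpha(z):A_\Phi(z)\to\operatorname{Sing}V$ is $[g]\mapsto\sum_{i_1<\dots<i_k}\big([g],\big[\tfrac{d_{i_1,\dots,i_k}}{f_{i_1}\cdots f_{i_k}}\big]\big)_zF_{i_1,\dots,i_k}$. Put $w_{i_1,\dots,i_k}=a_{i_1}\cdots a_{i_k}\big[\tfrac{d_{i_1,\dots,i_k}}{f_{i_1}\cdots f_{i_k}}\big]$. The number $c\in\mathbb C\setminus\{0\}$ is the constant, independent of $z$ and of the indices, such that $\alpha(z)(w_{i_1,\dots,i_k})=c\,v_{i_1,\dots,i_k}$ for all distinct $i_1,\dots,i_k\in J$ and all $z\in\mathbb C^n-\Delta$ (such a constant exists). *)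

theory Defs
  imports "HOL-Analysis.Analysis" "HOL-Algebra.QuotRing" "Jordan_Normal_Form.Determinant"
begin

text \<open>
  Indices and coordinates are numbered from 1: a point of \<open>\<complex>\<^sup>N\<close> is a function on \<open>{1..N}\<close>,
  extended by \<^const>\<open>undefined\<close>.  A multi-index \<open>i\<^sub>1, \<dots>, i\<^sub>r\<close> is a list; list
  positions start at 0, so \<open>i\<^sub>m\<close> is \<open>I ! (m - 1)\<close>.  The linear functions are
  \<open>g\<^sub>j(t) = (\<Sum>m=1..k. b j m * t m)\<close>.
\<close>

definition cspace :: "nat \<Rightarrow> (nat \<Rightarrow> complex) set" where
  "cspace N = {1..N} \<rightarrow>\<^sub>E UNIV"

definition partial :: "nat \<Rightarrow> ((nat \<Rightarrow> complex) \<Rightarrow> complex) \<Rightarrow> (nat \<Rightarrow> complex) \<Rightarrow> complex" where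
  "partial i F x = deriv (\<lambda>s. F (x(i := s))) (x i)"

definition iter_partial ::
    "nat list \<Rightarrow> ((nat \<Rightarrow> complex) \<Rightarrow> complex) \<Rightarrow> (nat \<Rightarrow> complex) \<Rightarrow> complex" where
  "iter_partial ms F = foldr partial ms F"

definition incr_idx :: "nat \<Rightarrow> nat \<Rightarrow> nat list set" where
  "incr_idx n r = {I. length I = r \<and> sorted_wrt (<) I \<and> set I \<subseteq> {1..n}}"

definition omit :: "nat \<Rightarrow> nat list \<Rightarrow> nat list" where
  "omit m I = take m I @ drop (Suc m) I"

definition idx_sign :: "nat list \<Rightarrow> complex" where
  "idx_sign I = (if distinct I
     then (-1) ^ card {(p, q). p < q \<and> q < length I \<and> I ! q < I ! p} else 0)"


subsection \<open>The arrangement and its discriminant\<close>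

definition d_minor :: "nat \<Rightarrow> (nat \<Rightarrow> nat \<Rightarrow> complex) \<Rightarrow> nat list \<Rightarrow> complex" where
  "d_minor k b I = Determinant.det (Matrix.mat k k (\<lambda>(l, m). b (I ! l) (m + 1)))"

definition f_lin ::
    "nat \<Rightarrow> (nat \<Rightarrow> nat \<Rightarrow> complex) \<Rightarrow> nat \<Rightarrow> (nat \<Rightarrow> complex) \<Rightarrow> (nat \<Rightarrow> complex) \<Rightarrow> complex" where
  "f_lin k b j z t = z j + (\<Sum>m=1..k. b j m * t m)"

text \<open>For \<open>I\<close> of length \<open>k + 1\<close>; the sign \<open>(-1)\<^sup>m\<^sup>-\<^sup>1\<close> becomes \<open>(-1)\<^sup>m\<close> as positions start at 0.\<close>

definition f_disc :: "nat \<Rightarrow> (nat \<Rightarrow> nat \<Rightarrow> complex) \<Rightarrow> nat list \<Rightarrow> (nat \<Rightarrow> complex) \<Rightarrow> complex" where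
  "f_disc k b I z = (\<Sum>m<k+1. (-1) ^ m * z (I ! m) * d_minor k b (omit m I))"

definition discriminant :: "nat \<Rightarrow> nat \<Rightarrow> (nat \<Rightarrow> nat \<Rightarrow> complex) \<Rightarrow> (nat \<Rightarrow> complex) set" where
  "discriminant n k b = {z \<in> cspace n. \<exists>I\<in>incr_idx n (k+1). f_disc k b I z = 0}"


subsection \<open>The space \<open>V\<close>, its bilinear form and the Gauss-Manin operators\<close>

text \<open>
  A vector \<open>u\<close> of \<open>V\<close> is the family of its coordinates in the basis of the \<open>F\<^sub>I\<close>,
  \<open>I \<in> incr_idx n k\<close>, set to 0 elsewhere.  \<open>F_vec\<close> and \<open>coord\<close> are the skew-symmetric
  extensions to arbitrary multi-indices of the basis vectors and of the coordinates.
\<close>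

type_synonym V_vec = "nat list \<Rightarrow> complex"

definition F_vec :: "nat list \<Rightarrow> V_vec" where
  "F_vec I = (\<lambda>X. if X = sort I then idx_sign I else 0)"

definition coord :: "V_vec \<Rightarrow> nat list \<Rightarrow> complex" where
  "coord u I = idx_sign I * u (sort I)"

definition S_form :: "nat \<Rightarrow> nat \<Rightarrow> (nat \<Rightarrow> complex) \<Rightarrow> V_vec \<Rightarrow> V_vec \<Rightarrow> complex" where
  "S_form n k a u v = (\<Sum>I\<in>incr_idx n k. (\<Prod>m<k. a (I ! m)) * u I * v I)"

definition v_vec :: "nat \<Rightarrow> nat \<Rightarrow> (nat \<Rightarrow> complex) \<Rightarrow> nat list \<Rightarrow> V_vec" where
  "v_vec n k a I = (\<lambda>X. F_vec I X -
     (\<Sum>m<k. a (I ! m) / (\<Sum>j=1..n. a j) * (\<Sum>j=1..n. F_vec (I[m := j]) X)))"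

text \<open>
  The linear map with
  \<open>F\<^bsub>omit m I\<^esub> \<mapsto> (-1)\<^sup>m (\<Sum>l\<le>k. (-1)\<^sup>l a(I ! l) F\<^bsub>omit l I\<^esub>)\<close> that kills the other basis
  vectors; the product of the two signs does not change when positions are counted from 0, and
  the map depends only on the set of entries of \<open>I\<close>.
\<close>

definition L_op :: "nat \<Rightarrow> (nat \<Rightarrow> complex) \<Rightarrow> nat list \<Rightarrow> V_vec \<Rightarrow> V_vec" where
  "L_op k a I u = (\<lambda>X. \<Sum>m<k+1. coord u (omit m I) *
     ((-1) ^ m * (\<Sum>l<k+1. (-1) ^ l * a (I ! l) * F_vec (omit l I) X)))"

text \<open>A \<open>k\<close>-element subset is enumerated increasingly; the summand does not depend on the order.\<close>

definition K_op :: "nat \<Rightarrow> nat \<Rightarrow> (nat \<Rightarrow> nat \<Rightarrow> complex) \<Rightarrow> (nat \<Rightarrow> complex) \<Rightarrow>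
    nat \<Rightarrow> (nat \<Rightarrow> complex) \<Rightarrow> V_vec \<Rightarrow> V_vec" where
  "K_op n k b a i z u = (\<lambda>X. \<Sum>I\<in>{I \<in> incr_idx n k. i \<notin> set I}.
     d_minor k b I / f_disc k b (i # I) z * L_op k a (i # I) u X)"


subsection \<open>The master function and the algebra of functions on its critical set\<close>

definition U_compl ::
    "nat \<Rightarrow> nat \<Rightarrow> (nat \<Rightarrow> nat \<Rightarrow> complex) \<Rightarrow> (nat \<Rightarrow> complex) \<Rightarrow> (nat \<Rightarrow> complex) set" where
  "U_compl n k b z = {t \<in> cspace k. \<forall>j\<in>{1..n}. f_lin k b j z t \<noteq> 0}"

text \<open>
  The multivalued master function \<open>\<Phi>(z, t) = \<Sum>\<^sub>j a\<^sub>j log f\<^sub>j(z, t)\<close> enters only through its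
  derivatives.  \<open>Phi_germ z t\<^sub>0\<close> is a branch which is holomorphic near \<open>t\<^sub>0\<close>: the principal
  logarithm is only applied to \<open>f\<^sub>j(z, t) / f\<^sub>j(z, t\<^sub>0)\<close>, which is close to 1.
\<close>

definition Phi_germ :: "nat \<Rightarrow> nat \<Rightarrow> (nat \<Rightarrow> nat \<Rightarrow> complex) \<Rightarrow> (nat \<Rightarrow> complex) \<Rightarrow>
    (nat \<Rightarrow> complex) \<Rightarrow> (nat \<Rightarrow> complex) \<Rightarrow> (nat \<Rightarrow> complex) \<Rightarrow> complex" where
  "Phi_germ n k b a z t0 t =
     (\<Sum>j=1..n. a j * (Ln (f_lin k b j z t0) + Ln (f_lin k b j z t / f_lin k b j z t0)))"

definition dPhi :: "nat \<Rightarrow> nat \<Rightarrow> (nat \<Rightarrow> nat \<Rightarrow> complex) \<Rightarrow> (nat \<Rightarrow> complex) \<Rightarrow>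
    (nat \<Rightarrow> complex) \<Rightarrow> nat \<Rightarrow> (nat \<Rightarrow> complex) \<Rightarrow> complex" where
  "dPhi n k b a z m t = partial m (Phi_germ n k b a z t) t"

definition hess_Phi :: "nat \<Rightarrow> nat \<Rightarrow> (nat \<Rightarrow> nat \<Rightarrow> complex) \<Rightarrow> (nat \<Rightarrow> complex) \<Rightarrow>
    (nat \<Rightarrow> complex) \<Rightarrow> (nat \<Rightarrow> complex) \<Rightarrow> complex" where
  "hess_Phi n k b a z t = Determinant.det (Matrix.mat k k
     (\<lambda>(l, m). partial (m + 1) (dPhi n k b a z (l + 1)) t))"

definition crit_set :: "nat \<Rightarrow> nat \<Rightarrow> (nat \<Rightarrow> nat \<Rightarrow> complex) \<Rightarrow> (nat \<Rightarrow> complex) \<Rightarrow>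
    (nat \<Rightarrow> complex) \<Rightarrow> (nat \<Rightarrow> complex) set" where
  "crit_set n k b a z = {t \<in> U_compl n k b z. \<forall>m\<in>{1..k}. dPhi n k b a z m t = 0}"

definition poly_funs :: "nat \<Rightarrow> ((nat \<Rightarrow> complex) \<Rightarrow> complex) set" where
  "poly_funs k = {\<lambda>t. \<Sum>e\<in>E. c e * (\<Prod>m=1..k. t m ^ e m) | E c. finite (E :: (nat \<Rightarrow> nat) set)}"

text \<open>
  Rational functions regular on \<open>U\<close>, identified with the functions they define on \<open>U\<close>.
  As polynomial rings over \<open>\<complex>\<close> are factorial, regularity on \<open>U\<close> means that there is a single
  fraction whose denominator has no zero on \<open>U\<close>.
\<close>

definition regular_ring ::
    "nat \<Rightarrow> (nat \<Rightarrow> complex) set \<Rightarrow> ((nat \<Rightarrow> complex) \<Rightarrow> complex) ring" where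
  "regular_ring k U =
    \<lparr>carrier = {restrict (\<lambda>t. P t / Q t) U | P Q.
       P \<in> poly_funs k \<and> Q \<in> poly_funs k \<and> (\<forall>t\<in>U. Q t \<noteq> 0)},
     monoid.mult = (\<lambda>g h. restrict (\<lambda>t. g t * h t) U),
     one = restrict (\<lambda>_. 1) U,
     zero = restrict (\<lambda>_. 0) U,
     add = (\<lambda>g h. restrict (\<lambda>t. g t + h t) U)\<rparr>"

definition jac_ideal :: "nat \<Rightarrow> nat \<Rightarrow> (nat \<Rightarrow> nat \<Rightarrow> complex) \<Rightarrow> (nat \<Rightarrow> complex) \<Rightarrow>
    (nat \<Rightarrow> complex) \<Rightarrow> ((nat \<Rightarrow> complex) \<Rightarrow> complex) set" where
  "jac_ideal n k b a z = genideal (regular_ring k (U_compl n k b z))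
     ((\<lambda>m. restrict (dPhi n k b a z m) (U_compl n k b z)) ` {1..k})"

definition A_Phi :: "nat \<Rightarrow> nat \<Rightarrow> (nat \<Rightarrow> nat \<Rightarrow> complex) \<Rightarrow> (nat \<Rightarrow> complex) \<Rightarrow>
    (nat \<Rightarrow> complex) \<Rightarrow> ((nat \<Rightarrow> complex) \<Rightarrow> complex) set ring" where
  "A_Phi n k b a z = regular_ring k (U_compl n k b z) Quot jac_ideal n k b a z"

definition A_class :: "nat \<Rightarrow> nat \<Rightarrow> (nat \<Rightarrow> nat \<Rightarrow> complex) \<Rightarrow> (nat \<Rightarrow> complex) \<Rightarrow>
    (nat \<Rightarrow> complex) \<Rightarrow> ((nat \<Rightarrow> complex) \<Rightarrow> complex) \<Rightarrow> ((nat \<Rightarrow> complex) \<Rightarrow> complex) set" where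
  "A_class n k b a z g = a_r_coset (regular_ring k (U_compl n k b z)) (jac_ideal n k b a z)
     (restrict g (U_compl n k b z))"


subsection \<open>The residue form\<close>

text \<open>
  The cycle \<open>|\<partial>\<Phi>/\<partial>t\<^sub>m| = \<epsilon>\<^sub>m\<close>, \<open>m = 1, \<dots>, k\<close>, inside the polydisc of radius \<open>r\<close> about \<open>p\<close>.
  \<open>cycle_fibre\<close> is the set of its points where \<open>\<partial>\<Phi>/\<partial>t\<^sub>m\<close> has argument \<open>\<theta>\<^sub>m\<close> for all \<open>m\<close>.
\<close>

definition cycle_fibre :: "nat \<Rightarrow> nat \<Rightarrow> (nat \<Rightarrow> nat \<Rightarrow> complex) \<Rightarrow> (nat \<Rightarrow> complex) \<Rightarrow>
    (nat \<Rightarrow> complex) \<Rightarrow> (nat \<Rightarrow> complex) \<Rightarrow> real \<Rightarrow> (nat \<Rightarrow> real) \<Rightarrow> (nat \<Rightarrow> real) \<Rightarrow>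
    (nat \<Rightarrow> complex) set" where
  "cycle_fibre n k b a z p r \<epsilon> \<theta> = {t \<in> U_compl n k b z.
     (\<forall>m\<in>{1..k}. cmod (t m - p m) < r) \<and>
     (\<forall>m\<in>{1..k}. dPhi n k b a z m t = of_real (\<epsilon> m) * cis (\<theta> m))}"

text \<open>
  The integral over the cycle of \<open>h dt\<^sub>1 \<and> \<dots> \<and> dt\<^sub>k\<close>, computed in the coordinates
  \<open>\<theta>\<^sub>m = arg (\<partial>\<Phi>/\<partial>t\<^sub>m)\<close>, which are positive for the orientation
  \<open>d arg (\<partial>\<Phi>/\<partial>t\<^sub>1) \<and> \<dots> \<and> d arg (\<partial>\<Phi>/\<partial>t\<^sub>k) > 0\<close>.  On the cycle
  \<open>d(\<partial>\<Phi>/\<partial>t\<^sub>m) = \<i> (\<partial>\<Phi>/\<partial>t\<^sub>m) d\<theta>\<^sub>m\<close>, hence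
  \<open>dt\<^sub>1 \<and> \<dots> \<and> dt\<^sub>k = (\<Prod>m. \<i> (\<partial>\<Phi>/\<partial>t\<^sub>m)) / det (\<partial>\<^sup>2\<Phi>/\<partial>t\<^sub>l\<partial>t\<^sub>m) d\<theta>\<^sub>1 \<and> \<dots> \<and> d\<theta>\<^sub>k\<close>.
  The cycle may cover the torus of arguments several times, whence the sum over the fibre.  The
  fibres are finite, and the Hessian vanishes on them only over a null set of \<open>\<theta>\<close>.
\<close>

definition cycle_integral :: "nat \<Rightarrow> nat \<Rightarrow> (nat \<Rightarrow> nat \<Rightarrow> complex) \<Rightarrow> (nat \<Rightarrow> complex) \<Rightarrow>
    (nat \<Rightarrow> complex) \<Rightarrow> (nat \<Rightarrow> complex) \<Rightarrow> real \<Rightarrow> (nat \<Rightarrow> real) \<Rightarrow>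
    ((nat \<Rightarrow> complex) \<Rightarrow> complex) \<Rightarrow> complex" where
  "cycle_integral n k b a z p r \<epsilon> h =
     set_lebesgue_integral (Pi\<^sub>M {1..k} (\<lambda>_. lborel)) ({1..k} \<rightarrow>\<^sub>E {0..2*pi})
       (\<lambda>\<theta>. \<Sum>t\<in>cycle_fibre n k b a z p r \<epsilon> \<theta>.
          h t * ((\<Prod>m=1..k. \<i> * dPhi n k b a z m t) / hess_Phi n k b a z t))"

text \<open>
  The Grothendieck residue at \<open>p\<close> of \<open>g\<close>: the common value for all sufficiently small radii
  \<open>r\<close> (the meaning of "near \<open>p\<close>") and all \<open>\<epsilon>\<^sub>m\<close> sufficiently small with respect to \<open>r\<close>.
\<close>

definition groth_residue :: "nat \<Rightarrow> nat \<Rightarrow> (nat \<Rightarrow> nat \<Rightarrow> complex) \<Rightarrow> (nat \<Rightarrow> complex) \<Rightarrow>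
    (nat \<Rightarrow> complex) \<Rightarrow> (nat \<Rightarrow> complex) \<Rightarrow> ((nat \<Rightarrow> complex) \<Rightarrow> complex) \<Rightarrow> complex" where
  "groth_residue n k b a z p g = (THE R.
     \<forall>\<^sub>F r in at_right (0::real). \<forall>\<^sub>F \<delta> in at_right (0::real).
       \<forall>\<epsilon>. (\<forall>m\<in>{1..k}. 0 < \<epsilon> m \<and> \<epsilon> m < \<delta>) \<longrightarrow>
         1 / (2 * of_real pi * \<i>) ^ k *
           cycle_integral n k b a z p r \<epsilon> (\<lambda>t. g t / (\<Prod>m=1..k. dPhi n k b a z m t)) = R)"

text \<open>The form on classes is the common value on all representatives.\<close>

definition res_form :: "nat \<Rightarrow> nat \<Rightarrow> (nat \<Rightarrow> nat \<Rightarrow> complex) \<Rightarrow> (nat \<Rightarrow> complex) \<Rightarrow>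
    (nat \<Rightarrow> complex) \<Rightarrow> ((nat \<Rightarrow> complex) \<Rightarrow> complex) set \<Rightarrow>
    ((nat \<Rightarrow> complex) \<Rightarrow> complex) set \<Rightarrow> complex" where
  "res_form n k b a z X Y = (THE R. \<forall>g\<in>X. \<forall>h\<in>Y.
     (\<Sum>p\<in>crit_set n k b a z. groth_residue n k b a z p (\<lambda>t. g t * h t)) = R)"


subsection \<open>The canonical isomorphism and its normalizing constant\<close>

definition df_fun :: "nat \<Rightarrow> (nat \<Rightarrow> nat \<Rightarrow> complex) \<Rightarrow> (nat \<Rightarrow> complex) \<Rightarrow> nat list \<Rightarrow>
    (nat \<Rightarrow> complex) \<Rightarrow> complex" where
  "df_fun k b z I t = d_minor k b I / (\<Prod>m<k. f_lin k b (I ! m) z t)"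

definition alpha_iso :: "nat \<Rightarrow> nat \<Rightarrow> (nat \<Rightarrow> nat \<Rightarrow> complex) \<Rightarrow> (nat \<Rightarrow> complex) \<Rightarrow>
    (nat \<Rightarrow> complex) \<Rightarrow> ((nat \<Rightarrow> complex) \<Rightarrow> complex) set \<Rightarrow> V_vec" where
  "alpha_iso n k b a z = (\<lambda>X\<in>carrier (A_Phi n k b a z).
     (\<lambda>Y. \<Sum>I\<in>incr_idx n k. res_form n k b a z X (A_class n k b a z (df_fun k b z I)) * F_vec I Y))"

definition w_class :: "nat \<Rightarrow> nat \<Rightarrow> (nat \<Rightarrow> nat \<Rightarrow> complex) \<Rightarrow> (nat \<Rightarrow> complex) \<Rightarrow>
    (nat \<Rightarrow> complex) \<Rightarrow> nat list \<Rightarrow> ((nat \<Rightarrow> complex) \<Rightarrow> complex) set" where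
  "w_class n k b a z I = A_class n k b a z (\<lambda>t. (\<Prod>m<k. a (I ! m)) * df_fun k b z I t)"

definition is_normalizing_const ::
    "nat \<Rightarrow> nat \<Rightarrow> (nat \<Rightarrow> nat \<Rightarrow> complex) \<Rightarrow> (nat \<Rightarrow> complex) \<Rightarrow> complex \<Rightarrow> bool" where
  "is_normalizing_const n k b a c \<longleftrightarrow> c \<noteq> 0 \<and>
     (\<forall>z \<in> cspace n - discriminant n k b.
        \<forall>I. length I = k \<and> distinct I \<and> set I \<subseteq> {1..n} \<longrightarrow>
          alpha_iso n k b a z (w_class n k b a z I) = (\<lambda>X. c * v_vec n k a I X))"


subsection \<open>The potential\<close>

text \<open>
  \<open>lg\<close> assigns to each \<open>I\<close> a branch of \<open>log f\<^sub>I\<close> on an open subset \<open>W\<close> of \<open>\<complex>\<^sup>n\<close>.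
\<close>

definition log_branches :: "nat \<Rightarrow> nat \<Rightarrow> (nat \<Rightarrow> nat \<Rightarrow> complex) \<Rightarrow> (nat \<Rightarrow> complex) set \<Rightarrow>
    (nat list \<Rightarrow> (nat \<Rightarrow> complex) \<Rightarrow> complex) \<Rightarrow> bool" where
  "log_branches n k b W lg \<longleftrightarrow> openin (top_of_set (cspace n)) W \<and>
     (\<forall>I\<in>incr_idx n (k+1). continuous_on W (lg I) \<and> (\<forall>w\<in>W. exp (lg I w) = f_disc k b I w))"

definition P_tilde :: "nat \<Rightarrow> nat \<Rightarrow> (nat \<Rightarrow> nat \<Rightarrow> complex) \<Rightarrow> (nat \<Rightarrow> complex) \<Rightarrow> complex \<Rightarrow>
    (nat list \<Rightarrow> (nat \<Rightarrow> complex) \<Rightarrow> complex) \<Rightarrow> (nat \<Rightarrow> complex) \<Rightarrow> complex" where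
  "P_tilde n k b a c lg z = c\<^sup>2 / fact (2 * k) *
     (\<Sum>I\<in>incr_idx n (k+1).
        (\<Prod>l<k+1. a (I ! l)) / (\<Prod>l<k+1. (d_minor k b (omit l I))\<^sup>2) *
        f_disc k b I z ^ (2 * k) * lg I z)"

end

theory Submission
  imports Defs
begin

text \<open>
  Both sides are sums over the \<open>k + 1\<close>-element sets \<open>J\<close>, and they agree term by term.

  On the algebraic side, \<open>L\<^sub>J\<close> has rank one and is self-adjoint:
  \<open>S(L\<^sub>J u, v) = (\<Prod>x\<in>J. a\<^sub>x) \<phi>\<^sub>J(u) \<phi>\<^sub>J(v)\<close>, where \<open>\<phi>\<^sub>J(u)\<close> is the alternating sum of the
  coordinates of \<open>u\<close> over the faces of \<open>J\<close> (\<open>face_sum\<close>, \<open>S_form_L_op\<close>).  On the analytic side,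
  \<open>f\<^sub>J\<close> is linear in \<open>z\<close>; let \<open>s\<^sub>i = \<partial>f\<^sub>J/\<partial>z\<^sub>i\<close> (\<open>slope\<close>), which up to sign is the minor of \<open>J\<close>
  without \<open>i\<close>, and is 0 for \<open>i\<close> outside \<open>J\<close>.  Since \<open>x\<^sup>2\<^sup>k log x\<close> has the \<open>(2k + 1)\<close>-st derivative
  \<open>(2k)!/x\<close>, differentiating \<open>f\<^sub>J\<^sup>2\<^sup>k log f\<^sub>J\<close> along \<open>m\<^sub>0, \<dots>, m\<^sub>2\<^sub>k\<close> gives \<open>(2k)! (\<Prod>r. s(m\<^sub>r)) / f\<^sub>J\<close>
  (\<open>iter_partial_power_log_sum_top\<close>).

  The bridge is the identity \<open>\<phi>\<^sub>J(v\<^sub>M) (\<Prod>x\<in>J. s\<^sub>x) = d\<^sub>M (\<Prod>i\<in>M. s\<^sub>i)\<close> (\<open>face_sum_v_vec_mult\<close>).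
  With \<open>F\<^sub>M\<close> instead of \<open>v\<^sub>M\<close> it only records that the product over \<open>M\<close> lacks one factor of the
  product over \<open>J\<close>, namely the slope at the omitted index, which is \<open>\<plusminus>d\<^sub>M\<close>.  The correction
  terms \<open>\<Sum>\<^sub>j F\<close>, \<open>j\<close> replacing an entry of \<open>M\<close>, are killed by \<open>\<phi>\<^sub>J\<close>: by the same identity this is
  the Pluecker relation \<open>\<Sum>\<^sub>j d(M[p := j]) s\<^sub>j = 0\<close> (\<open>pluecker_slope\<close>), which says that \<open>f\<^sub>J\<close> vanishes on
  the image of \<open>b\<close>.

  The operator \<open>K\<close> at \<open>m\<^sub>0\<close> sums over the \<open>J\<close> that contain \<open>m\<^sub>0\<close>, listed with \<open>m\<^sub>0\<close> first.  As \<open>f\<^sub>J\<close> and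
  its slopes are determinants, passing to the increasing order only changes signs, which cancel
  (\<open>contribution_sort\<close>).  The factor \<open>c\<^sup>2\<close> occurs on both sides.
\<close>

section \<open>Signs of multi-indices and determinants\<close>

lemma idx_sign_Cons:
  "idx_sign (x # xs) =
     (if x \<in> set xs then 0 else (-1) ^ length (filter (\<lambda>y. y < x) xs) * idx_sign xs)"
proof -
  let ?N = "{(p, q). p < q \<and> q < length xs \<and> xs ! q < xs ! p}"
  let ?A = "(\<lambda>q. (0::nat, Suc q)) ` {q. q < length xs \<and> xs ! q < x}"
  let ?B = "(\<lambda>(p, q). (Suc p, Suc q)) ` ?N"
  have fin: "finite ?N"
    by (rule finite_subset[of _ "{..<length xs} \<times> {..<length xs}"]) auto
  have "{(p, q). p < q \<and> q < length (x # xs) \<and> (x # xs) ! q < (x # xs) ! p} = ?A \<union> ?B"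
    (is "?L = _")
  proof (rule Set.set_eqI)
    fix pq :: "nat \<times> nat"
    obtain p q where pq: "pq = (p, q)" by (cases pq)
    show "pq \<in> ?L \<longleftrightarrow> pq \<in> ?A \<union> ?B"
      unfolding pq by (cases p; cases q) (auto simp: image_iff)
  qed
  moreover have "card (?A \<union> ?B) = card ?A + card ?B"
    using fin by (intro card_Un_disjoint) auto
  moreover have "card ?A = length (filter (\<lambda>y. y < x) xs)"
    by (subst card_image) (auto simp: inj_on_def length_filter_conv_card)
  moreover have "card ?B = card ?N"
    by (subst card_image) (auto simp: inj_on_def)
  ultimately show ?thesis
    by (auto simp: idx_sign_def power_add)
qed

lemma idx_sign_square: "distinct I \<Longrightarrow> idx_sign I * idx_sign I = 1"
  by (simp add: idx_sign_def flip: power_add mult_2)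

lemma idx_sign_eq_0: "\<not> distinct I \<Longrightarrow> idx_sign I = 0"
  by (simp add: idx_sign_def)

text \<open>
  The element travels to its place by adjacent transpositions, one for each smaller entry of the
  sorted list.
\<close>

lemma alternating_insort:
  fixes f :: "nat list \<Rightarrow> complex"
  assumes alt: "\<And>pre x y post. length pre + length post + 2 = r \<Longrightarrow>
      f (pre @ x # y # post) = - f (pre @ y # x # post)"
    and "sorted s" and "length pre + length s + 1 = r"
  shows "f (pre @ x # s) = (-1) ^ length (filter (\<lambda>y. y < x) s) * f (pre @ insort x s)"
  using assms(2,3)
proof (induction s arbitrary: pre)
  case Nil
  then show ?case by simp
next
  case (Cons y s)
  show ?case
  proof (cases "x \<le> y")
    case True
    then have "filter (\<lambda>y. y < x) (y # s) = []"
      using Cons.prems by (auto simp: filter_empty_conv)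
    then show ?thesis using True by simp
  next
    case False
    have "f (pre @ x # y # s) = - f (pre @ y # x # s)"
      using Cons.prems by (intro alt) simp
    also have "f (pre @ y # x # s) =
        (-1) ^ length (filter (\<lambda>y. y < x) s) * f (pre @ y # insort x s)"
      using Cons.IH[of "pre @ [y]"] Cons.prems by simp
    finally show ?thesis using False by simp
  qed
qed

text \<open>
  Insertion sort uses as many adjacent transpositions as the list has inversions, and each of
  them changes the sign.  The unsorted prefix is what the induction has to carry along.
\<close>

lemma alternating_sort:
  fixes f :: "nat list \<Rightarrow> complex"
  assumes alt: "\<And>pre x y post. length pre + length post + 2 = r \<Longrightarrow>
      f (pre @ x # y # post) = - f (pre @ y # x # post)"
    and "distinct M" and "length pre + length M = r"
  shows "f (pre @ M) = idx_sign M * f (pre @ sort M)"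
  using assms(2,3)
proof (induction M arbitrary: pre)
  case Nil
  then show ?case by (simp add: idx_sign_def)
next
  case (Cons x M)
  have "f (pre @ x # M) = idx_sign M * f (pre @ x # sort M)"
    using Cons.IH[of "pre @ [x]"] Cons.prems by simp
  also have "f (pre @ x # sort M) =
      (-1) ^ length (filter (\<lambda>y. y < x) (sort M)) * f (pre @ insort x (sort M))"
    using Cons.prems by (intro alternating_insort[where f = f and r = r] alt) auto
  finally show ?case
    using Cons.prems by (simp add: idx_sign_Cons filter_sort)
qed

definition row_det :: "nat \<Rightarrow> (nat \<Rightarrow> nat \<Rightarrow> complex) \<Rightarrow> nat list \<Rightarrow> complex" where
  "row_det r h I = Determinant.det (Matrix.mat r r (\<lambda>(l, m). h (I ! l) m))"

lemma row_det_swap: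
  assumes "length pre + length post + 2 = r"
  shows "row_det r h (pre @ x # y # post) = - row_det r h (pre @ y # x # post)"
proof -
  let ?A = "Matrix.mat r r (\<lambda>(l, m). h ((pre @ y # x # post) ! l) m)"
  let ?p = "length pre"
  have "Matrix.mat r r (\<lambda>(l, m). h ((pre @ x # y # post) ! l) m) = swaprows ?p (Suc ?p) ?A"
    using assms by (intro eq_matI) (auto simp: nth_append nth_Cons' intro!: arg_cong2[of _ _ _ _ h])
  then show ?thesis
    unfolding row_det_def using assms by (simp add: det_swaprows[of ?p r "Suc ?p" ?A])
qed

lemma row_det_eq_0:
  assumes "\<not> distinct I" and "length I = r"
  shows "row_det r h I = 0"
proof -
  obtain i j where "i < r" "j < r" "i \<noteq> j" "I ! i = I ! j"
    using assms by (auto simp: distinct_conv_nth)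
  then show ?thesis
    unfolding row_det_def by (intro det_identical_rows[of _ r i j]) (auto intro!: eq_vecI)
qed

lemma row_det_sort:
  assumes "length I = r"
  shows "row_det r h I = idx_sign I * row_det r h (sort I)"
proof (cases "distinct I")
  case True
  then have "row_det r h ([] @ I) = idx_sign I * row_det r h ([] @ sort I)"
    using assms by (intro alternating_sort[where r = r] row_det_swap) auto
  then show ?thesis by simp
next
  case False
  then show ?thesis using assms by (simp add: row_det_eq_0 idx_sign_eq_0)
qed

lemma d_minor_row_det: "d_minor k b I = row_det k (\<lambda>x m. b x (m + 1)) I"
  by (simp add: d_minor_def row_det_def)

lemma d_minor_sort: "length I = k \<Longrightarrow> d_minor k b I = idx_sign I * d_minor k b (sort I)"
  unfolding d_minor_row_det by (rule row_det_sort)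

lemma length_omit: "l < length I \<Longrightarrow> length (omit l I) = length I - 1"
  by (simp add: omit_def)

lemma nth_omit: "l < length I \<Longrightarrow> i < length I - 1 \<Longrightarrow>
    omit l I ! i = I ! (if i < l then i else Suc i)"
  by (auto simp: omit_def nth_append)

lemma omit_perm: "l < length I \<Longrightarrow> mset I = add_mset (I ! l) (mset (omit l I))"
  by (metis Cons_nth_drop_Suc append_take_drop_id mset.simps(2) mset_append omit_def
      union_mset_add_mset_right)

lemma set_omit:
  assumes "l < length I" and "distinct I"
  shows "set (omit l I) = set I - {I ! l}" and "distinct (omit l I)"
proof -
  have I: "I = take l I @ I ! l # drop (Suc l) I"
    using assms(1) by (simp add: id_take_nth_drop)
  have "distinct (take l I @ I ! l # drop (Suc l) I)"
    using assms(2) I by simp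
  then show "distinct (omit l I)"
    by (simp add: omit_def)
  have "set I = insert (I ! l) (set (omit l I))"
    using omit_perm[OF assms(1)] by (metis set_mset_add_mset_insert set_mset_mset)
  moreover have "I ! l \<notin> set (omit l I)"
    using \<open>distinct (take l I @ I ! l # drop (Suc l) I)\<close> by (auto simp: omit_def)
  ultimately show "set (omit l I) = set I - {I ! l}"
    by auto
qed

text \<open>
  Expanding the determinant along its first column, which contains the \<open>z\<^sub>i\<close>, gives the sum that
  defines \<open>f\<^sub>I\<close>.
\<close>

lemma f_disc_row_det:
  assumes "length I = k + 1"
  shows "f_disc k b I z = row_det (k + 1) (\<lambda>x m. if m = 0 then z x else b x m) I"
proof -
  let ?A = "Matrix.mat (k + 1) (k + 1) (\<lambda>(l, m). if m = 0 then z (I ! l) else b (I ! l) m)"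
  have "Determinant.det ?A = (\<Sum>l<k + 1. ?A $$ (l, 0) * cofactor ?A l 0)"
    by (rule laplace_expansion_column) auto
  also have "\<dots> = f_disc k b I z"
    unfolding f_disc_def
  proof (rule sum.cong)
    fix l assume l: "l \<in> {..<k + 1}"
    have "mat_delete ?A l 0 = Matrix.mat k k (\<lambda>(i, m). b (omit l I ! i) (m + 1))"
      using l assms by (intro eq_matI) (auto simp: mat_delete_def nth_omit)
    then show "?A $$ (l, 0) * cofactor ?A l 0 = (-1) ^ l * z (I ! l) * d_minor k b (omit l I)"
      using l by (simp add: cofactor_def d_minor_def)
  qed simp
  finally show ?thesis by (simp add: row_det_def)
qed

lemma f_disc_sort:
  "length I = k + 1 \<Longrightarrow> f_disc k b I z = idx_sign I * f_disc k b (sort I) z"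
  using row_det_sort[of I "k + 1"] by (simp add: f_disc_row_det)

section \<open>The slopes of the discriminant forms\<close>

text \<open>The coefficient of \<open>z\<^sub>i\<close> in \<open>f\<^sub>J\<close>.\<close>

definition slope :: "nat \<Rightarrow> (nat \<Rightarrow> nat \<Rightarrow> complex) \<Rightarrow> nat list \<Rightarrow> nat \<Rightarrow> complex" where
  "slope k b J i = f_disc k b J (\<lambda>x. if x = i then 1 else 0)"

lemma slope_nth:
  assumes "distinct J" and "length J = k + 1" and "l < k + 1"
  shows "slope k b J (J ! l) = (-1) ^ l * d_minor k b (omit l J)"
proof -
  have "slope k b J (J ! l) =
      (\<Sum>m<k + 1. if m = l then (-1) ^ m * d_minor k b (omit m J) else 0)"
    unfolding slope_def f_disc_def
    using assms by (intro sum.cong) (auto simp: nth_eq_iff_index_eq)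
  then show ?thesis using assms(3) by simp
qed

lemma slope_eq_0: "i \<notin> set J \<Longrightarrow> length J = k + 1 \<Longrightarrow> slope k b J i = 0"
  unfolding slope_def f_disc_def by (intro sum.neutral) auto

lemma slope_sort:
  "length J = k + 1 \<Longrightarrow> slope k b J i = idx_sign J * slope k b (sort J) i"
  unfolding slope_def by (rule f_disc_sort)

lemma f_disc_slope:
  assumes "set J \<subseteq> {1..n}" and "length J = k + 1"
  shows "f_disc k b J w = (\<Sum>i=1..n. w i * slope k b J i)"
proof -
  have "(\<Sum>i=1..n. w i * slope k b J i) =
      (\<Sum>m<k+1. \<Sum>i=1..n. if i = J ! m then (-1) ^ m * w i * d_minor k b (omit m J) else 0)"
    unfolding slope_def f_disc_def sum_distrib_left
    by (subst sum.swap) (auto intro!: sum.cong)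
  also have "\<dots> = f_disc k b J w"
    unfolding f_disc_def using assms nth_mem[of _ J]
    by (intro sum.cong) (auto simp: subset_iff)
  finally show ?thesis by simp
qed

lemma f_disc_upd:
  "f_disc k b J (w(i := s)) = f_disc k b J w + (s - w i) * slope k b J i"
  unfolding slope_def f_disc_def sum_distrib_left
  by (subst sum.distrib[symmetric]) (auto intro!: sum.cong simp: algebra_simps)

text \<open>
  The form \<open>f\<^sub>J\<close> vanishes on every column of \<open>b\<close>, because the determinant it expands then has two
  equal columns.
\<close>

lemma f_disc_column:
  assumes "length J = k + 1" and "m \<in> {1..k}"
  shows "f_disc k b J (\<lambda>x. b x m) = 0"
  unfolding f_disc_row_det[OF assms(1)] row_det_def
  using assms(2) by (intro det_identical_columns[of _ "k + 1" 0 m]) (auto intro!: eq_vecI)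

text \<open>
  A Pluecker relation.  As a function of \<open>j\<close>, the minor with \<open>j\<close> put into one position is a
  linear combination of the columns of \<open>b\<close>, on each of which \<open>f\<^sub>J\<close> vanishes.
\<close>

lemma pluecker_slope:
  assumes "set J \<subseteq> {1..n}" and "length J = k + 1" and "length M = k" and "p < k"
  shows "(\<Sum>j=1..n. d_minor k b (M[p := j]) * slope k b J j) = 0"
proof -
  define A where "A = (\<lambda>j. Matrix.mat k k (\<lambda>(l, m). b (M[p := j] ! l) (m + 1)))"
  have cof: "cofactor (A j) p m = cofactor (A 0) p m" if "m < k" for j m
  proof -
    have "mat_delete (A j) p m = mat_delete (A 0) p m"
      using assms that by (intro eq_matI) (auto simp: A_def mat_delete_def)
    then show ?thesis by (simp add: cofactor_def)
  qed
  have exp: "d_minor k b (M[p := j]) = (\<Sum>m<k. b j (m + 1) * cofactor (A 0) p m)" for j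
  proof -
    have "d_minor k b (M[p := j]) = (\<Sum>m<k. A j $$ (p, m) * cofactor (A j) p m)"
      unfolding d_minor_def A_def using assms by (intro laplace_expansion_row) auto
    also have "\<dots> = (\<Sum>m<k. b j (m + 1) * cofactor (A 0) p m)"
    proof (rule sum.cong)
      fix m assume "m \<in> {..<k}"
      then show "A j $$ (p, m) * cofactor (A j) p m = b j (m + 1) * cofactor (A 0) p m"
        using cof[of m j] assms by (simp add: A_def)
    qed simp
    finally show ?thesis .
  qed
  have "(\<Sum>j=1..n. d_minor k b (M[p := j]) * slope k b J j) =
      (\<Sum>m<k. cofactor (A 0) p m * (\<Sum>j=1..n. b j (m + 1) * slope k b J j))"
    unfolding exp sum_distrib_left sum_distrib_right
    by (subst sum.swap) (auto intro!: sum.cong)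
  also have "\<dots> = (\<Sum>m<k. cofactor (A 0) p m * f_disc k b J (\<lambda>x. b x (m + 1)))"
    unfolding f_disc_slope[OF assms(1,2)] ..
  also have "\<dots> = 0"
    using f_disc_column[OF assms(2)] by (intro sum.neutral) auto
  finally show ?thesis .
qed

section \<open>Matrix elements of the elementary operators\<close>

text \<open>
  The linear functional through which \<open>L\<^sub>J\<close> factors: in exterior algebra terms,
  the pairing of \<open>e \<and> u\<close> with the dual basis vector of \<open>J\<close>, where \<open>e\<close> is the sum of all basis
  vectors.
\<close>

definition face_sum :: "nat \<Rightarrow> nat list \<Rightarrow> V_vec \<Rightarrow> complex" where
  "face_sum k J u = (\<Sum>l<k + 1. (-1) ^ l * coord u (omit l J))"

lemma prod_nth_set:
  assumes "distinct J" and "length J = r"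
  shows "(\<Prod>l<r. g (J ! l)) = prod g (set J)"
  using assms by (metis bij_betw_nth prod.reindex_bij_betw)

text \<open>
  If \<open>M\<close> is contained in \<open>J\<close>, exactly one face of \<open>J\<close> has the same entries as \<open>M\<close>; the left-hand
  product has one factor more than the right-hand one, and this factor is \<open>\<plusminus>d\<^sub>M\<close> with the sign
  of the only term of the alternating sum.  Otherwise, and also when an entry of \<open>M\<close> repeats,
  both sides vanish.  Repetitions do occur when an entry of \<open>M\<close> is replaced by an arbitrary index.
\<close>

lemma face_sum_F_vec_mult:
  assumes J: "distinct J" "length J = k + 1" and M: "length M = k"
  shows "face_sum k J (F_vec M) * (\<Prod>l<k + 1. slope k b J (J ! l)) =
    d_minor k b M * (\<Prod>l<k. slope k b J (M ! l))"
proof -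
  have coord0: "coord (F_vec M) (omit l J) = 0"
    if "set (omit l J) \<noteq> set M \<or> \<not> distinct M" for l
  proof -
    have "sort (omit l J) \<noteq> sort M" if "set (omit l J) \<noteq> set M"
      using that by (metis set_sort)
    then show ?thesis
      using that by (auto simp: F_vec_def coord_def idx_sign_eq_0)
  qed
  consider "\<not> distinct M" | "distinct M" "\<not> set M \<subseteq> set J" | "distinct M" "set M \<subseteq> set J"
    by blast
  then show ?thesis
  proof cases
    case 1
    then have "d_minor k b M = 0"
      using M by (simp add: d_minor_row_det row_det_eq_0)
    with 1 show ?thesis by (simp add: face_sum_def coord0)
  next
    case 2
    then obtain i where "i < k" "M ! i \<notin> set J"
      using M by (metis in_set_conv_nth subsetI)
    then have "(\<Prod>l<k. slope k b J (M ! l)) = 0"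
      using slope_eq_0[OF _ J(2)] by (metis finite_lessThan lessThan_iff prod_zero)
    moreover have "set (omit l J) \<noteq> set M" if "l < k + 1" for l
      using 2 J that set_omit[of l J] by auto
    then have "face_sum k J (F_vec M) = 0"
      unfolding face_sum_def using coord0 by (intro sum.neutral) auto
    ultimately show ?thesis by simp
  next
    case 3
    have "card (set J - set M) = 1"
      using 3 J M by (simp add: card_Diff_subset distinct_card)
    then obtain x where x: "set J - set M = {x}"
      by (meson card_1_singletonE)
    then obtain q where q: "q < k + 1" "J ! q = x"
      using J by (metis DiffD1 in_set_conv_nth insertI1)
    have oq: "set (omit q J) = set M" "distinct (omit q J)" "length (omit q J) = k"
      using set_omit[of q J] q J x 3 by (auto simp: length_omit)
    then have srt: "sort (omit q J) = sort M"
      using 3 by (intro sorted_distinct_set_unique) auto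
    \<comment> \<open>only the face without the entry \<open>x\<close> outside \<open>M\<close> contributes to the alternating sum\<close>
    have other: "set (omit l J) \<noteq> set M" if "l < k + 1" "l \<noteq> q" for l
    proof -
      have "J ! l \<in> set J" "J ! l \<noteq> x"
        using that q J nth_eq_iff_index_eq[of J l q] nth_mem[of l J] by simp_all
      with x have "J ! l \<in> set M" by blast
      moreover have "J ! l \<notin> set (omit l J)"
        using set_omit(1)[of l J] that J by simp
      ultimately show ?thesis by blast
    qed
    have "face_sum k J (F_vec M) =
        (\<Sum>l<k + 1. if l = q then (-1) ^ q * coord (F_vec M) (omit q J) else 0)"
      unfolding face_sum_def using other coord0 by (intro sum.cong) auto
    then have fs: "face_sum k J (F_vec M) = (-1) ^ q * (idx_sign (omit q J) * idx_sign M)"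
      using q by (simp add: coord_def F_vec_def srt)
    have "set J = insert x (set M)" "x \<notin> set M"
      using x 3 by blast+
    then have "(\<Prod>l<k + 1. slope k b J (J ! l)) =
        (-1) ^ q * d_minor k b (omit q J) * (\<Prod>l<k. slope k b J (M ! l))"
      using 3 slope_nth[OF J q(1), of b] q(2)
      unfolding prod_nth_set[OF J, of "slope k b J"] prod_nth_set[OF 3(1) M, of "slope k b J"] by simp
    moreover have "idx_sign (omit q J) * d_minor k b (omit q J) = d_minor k b (sort M)"
      using d_minor_sort[OF oq(3), of b] idx_sign_square[OF oq(2)] srt
      by (metis mult.assoc mult_1)
    moreover have "((-1) ^ q * (-1) ^ q :: complex) = 1"
      by (simp flip: power_add mult_2)
    ultimately show ?thesis
      using d_minor_sort[OF M, of b] fs by (simp add: algebra_simps)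
  qed
qed

lemma coord_F_sum:
  "coord (\<lambda>X. f X - (\<Sum>m<k. r m * (\<Sum>j=1..n. g m j X))) I =
    coord f I - (\<Sum>m<k. r m * (\<Sum>j=1..n. coord (g m j) I))"
  by (simp add: coord_def algebra_simps sum_distrib_left)

lemma face_sum_v_vec_expand:
  "face_sum k J (v_vec n k a M) = face_sum k J (F_vec M) -
    (\<Sum>m<k. a (M ! m) / (\<Sum>j=1..n. a j) * (\<Sum>j=1..n. face_sum k J (F_vec (M[m := j]))))"
proof -
  have swap: "(\<Sum>l<k+1. (-1) ^ l * (\<Sum>m<k. r m * (\<Sum>j=1..n. g m j l))) =
     (\<Sum>m<k. r m * (\<Sum>j=1..n. \<Sum>l<k+1. (-1) ^ l * g m j l))" for r :: "nat \<Rightarrow> complex" and g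
  proof -
    have "(\<Sum>l<k+1. (-1) ^ l * (\<Sum>m<k. r m * (\<Sum>j=1..n. g m j l))) =
        (\<Sum>m<k. \<Sum>l<k+1. \<Sum>j=1..n. r m * ((-1) ^ l * g m j l))"
      unfolding sum_distrib_left by (subst sum.swap) (simp add: algebra_simps)
    also have "\<dots> = (\<Sum>m<k. \<Sum>j=1..n. \<Sum>l<k+1. r m * ((-1) ^ l * g m j l))"
      by (intro sum.cong refl sum.swap)
    finally show ?thesis by (simp only: sum_distrib_left)
  qed
  show ?thesis
    unfolding face_sum_def v_vec_def coord_F_sum right_diff_distrib sum_subtractf swap ..
qed

text \<open>
  Multiplied by the product of all slopes of \<open>J\<close>, which is not 0, the correction terms of \<open>v\<^sub>M\<close> turn
  into Pluecker relations, so \<open>v\<^sub>M\<close> and \<open>F\<^sub>M\<close> have the same value.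
\<close>

lemma face_sum_v_vec_mult:
  assumes J: "distinct J" "length J = k + 1" "set J \<subseteq> {1..n}" and M: "length M = k"
    and nz: "\<And>I. length I = k \<Longrightarrow> distinct I \<Longrightarrow> set I \<subseteq> {1..n} \<Longrightarrow> d_minor k b I \<noteq> 0"
  shows "face_sum k J (v_vec n k a M) * (\<Prod>l<k + 1. slope k b J (J ! l)) =
    d_minor k b M * (\<Prod>l<k. slope k b J (M ! l))"
proof -
  let ?\<Pi> = "\<Prod>l<k + 1. slope k b J (J ! l)"
  have \<Pi>: "?\<Pi> \<noteq> 0"
  proof -
    have "d_minor k b (omit l J) \<noteq> 0" if "l < k + 1" for l
      using that J set_omit[of l J] by (intro nz) (auto simp: length_omit)
    then show ?thesis
      using J by (simp add: slope_nth)
  qed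
  have "(\<Sum>j=1..n. face_sum k J (F_vec (M[p := j]))) = 0" if p: "p < k" for p
  proof -
    have split: "(\<Prod>l<k. slope k b J (M[p := j] ! l)) =
        slope k b J j * (\<Prod>l\<in>{..<k} - {p}. slope k b J (M ! l))" for j
      using p M by (subst prod.remove[of _ p]) (auto intro!: prod.cong)
    have "(\<Sum>j=1..n. face_sum k J (F_vec (M[p := j]))) * ?\<Pi> =
        (\<Sum>j=1..n. d_minor k b (M[p := j]) * slope k b J j) *
        (\<Prod>l\<in>{..<k} - {p}. slope k b J (M ! l))"
      unfolding sum_distrib_right
    proof (intro sum.cong refl)
      fix j
      have "length (M[p := j]) = k"
        using M by simp
      from face_sum_F_vec_mult[OF J(1,2) this, of b]
      show "face_sum k J (F_vec (M[p := j])) * ?\<Pi> = d_minor k b (M[p := j]) * slope k b J j *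
          (\<Prod>l\<in>{..<k} - {p}. slope k b J (M ! l))"
        by (simp only: split mult.assoc)
    qed
    also have "\<dots> = 0"
      using pluecker_slope[OF J(3,2) M p, of b] by simp
    finally show ?thesis using \<Pi> by simp
  qed
  then have "face_sum k J (v_vec n k a M) = face_sum k J (F_vec M)"
    by (simp add: face_sum_v_vec_expand)
  then show ?thesis
    by (simp only: face_sum_F_vec_mult[OF J(1,2) M])
qed

lemma sort_in_incr_idx:
  assumes "distinct I" and "set I \<subseteq> {1..n}" and "length I = r"
  shows "sort I \<in> incr_idx n r"
  using assms by (simp add: incr_idx_def strict_sorted_iff)

lemma finite_incr_idx: "finite (incr_idx n r)"
  by (rule finite_subset[OF _ finite_lists_length_eq[of "{1..n}" r]]) (auto simp: incr_idx_def)

lemma S_form_F_vec: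
  assumes "distinct I" and "set I \<subseteq> {1..n}" and "length I = k"
  shows "S_form n k a (F_vec I) v = (\<Prod>x\<in>set I. a x) * coord v I"
proof -
  have "S_form n k a (F_vec I) v =
      (\<Sum>X\<in>incr_idx n k. if X = sort I then (\<Prod>m<k. a (sort I ! m)) * idx_sign I * v (sort I) else 0)"
    unfolding S_form_def F_vec_def by (intro sum.cong) auto
  also have "\<dots> = (\<Prod>m<k. a (sort I ! m)) * idx_sign I * v (sort I)"
    using sort_in_incr_idx[OF assms] finite_incr_idx by simp
  also have "(\<Prod>m<k. a (sort I ! m)) = prod a (set (sort I))"
    using assms by (intro prod.reindex_bij_betw bij_betw_nth) auto
  finally show ?thesis by (simp add: coord_def)
qed

lemma S_form_sum_left:
  "S_form n k a (\<lambda>X. \<Sum>i\<in>A. r i * u i X) v = (\<Sum>i\<in>A. r i * S_form n k a (u i) v)"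
  unfolding S_form_def sum_distrib_left sum_distrib_right
  by (subst sum.swap) (simp add: algebra_simps)

text \<open>
  The weight of the face without \<open>x\<close> in the form \<open>S\<close> and the coefficient \<open>a\<^sub>x\<close> in \<open>L\<^sub>J\<close> multiply to
  the same product for every \<open>x\<close>, which makes \<open>L\<^sub>J\<close> self-adjoint of rank at most one.
\<close>

lemma S_form_L_op:
  assumes J: "distinct J" "length J = k + 1" "set J \<subseteq> {1..n}"
  shows "S_form n k a (L_op k a J u) v = (\<Prod>x\<in>set J. a x) * face_sum k J u * face_sum k J v"
proof -
  have "L_op k a J u = (\<lambda>X. \<Sum>l<k+1. (face_sum k J u * ((-1) ^ l * a (J ! l))) * F_vec (omit l J) X)"
    unfolding L_op_def face_sum_def sum_distrib_left sum_distrib_right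
    by (subst sum.swap) (simp add: algebra_simps)
  then have "S_form n k a (L_op k a J u) v =
      (\<Sum>l<k+1. (face_sum k J u * ((-1) ^ l * a (J ! l))) * S_form n k a (F_vec (omit l J)) v)"
    by (simp only: S_form_sum_left)
  also have "\<dots> = (\<Sum>l<k+1. (\<Prod>x\<in>set J. a x) * face_sum k J u * ((-1) ^ l * coord v (omit l J)))"
  proof (rule sum.cong)
    fix l assume l: "l \<in> {..<k + 1}"
    then have "S_form n k a (F_vec (omit l J)) v = (\<Prod>x\<in>set J - {J ! l}. a x) * coord v (omit l J)"
      using J set_omit[of l J] by (subst S_form_F_vec) (auto simp: length_omit)
    moreover have "(\<Prod>x\<in>set J. a x) = a (J ! l) * (\<Prod>x\<in>set J - {J ! l}. a x)"
      using l J by (intro prod.remove) auto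
    ultimately show "(face_sum k J u * ((-1) ^ l * a (J ! l))) * S_form n k a (F_vec (omit l J)) v =
        (\<Prod>x\<in>set J. a x) * face_sum k J u * ((-1) ^ l * coord v (omit l J))"
      by simp
  qed simp
  finally show ?thesis by (simp only: face_sum_def sum_distrib_left)
qed

section \<open>Derivatives of powers times logarithms\<close>

text \<open>
  A continuous logarithm is holomorphic: near a point it differs from its value there by the
  principal logarithm of a quotient close to 1.
\<close>

lemma has_field_derivative_continuous_log:
  fixes f g :: "complex \<Rightarrow> complex"
  assumes cont: "isCont g s" and ev: "\<forall>\<^sub>F x in nhds s. exp (g x) = f x"
    and f: "(f has_field_derivative f') (at s)"
  shows "(g has_field_derivative f' / f s) (at s)"
proof -
  have es: "exp (g s) = f s"
    using ev by (rule eventually_nhds_x_imp_x)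
  then have nz: "f s \<noteq> 0"
    by (metis exp_not_eq_zero)
  have "(g \<longlongrightarrow> g s) (nhds s)"
    using cont by (simp add: isCont_def tendsto_nhds_iff)
  then have "((\<lambda>x. \<bar>Im (g x - g s)\<bar>) \<longlongrightarrow> \<bar>Im (g s - g s)\<bar>) (nhds s)"
    by (intro tendsto_intros)
  then have "\<forall>\<^sub>F x in nhds s. \<bar>Im (g x - g s)\<bar> < pi"
    by (rule order_tendstoD) simp
  with ev have eq: "\<forall>\<^sub>F x in nhds s. g x = g s + Ln (f x / f s)"
  proof eventually_elim
    case (elim x)
    have "f x / f s = exp (g x - g s)"
      using elim es by (simp add: exp_diff)
    then show ?case
      using elim by (simp add: abs_less_iff)
  qed
  have "((\<lambda>x. g s + Ln (f x / f s)) has_field_derivative f' / f s) (at s)"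
    using nz by (auto intro!: derivative_eq_intros f)
  then show ?thesis
    using DERIV_cong_ev[OF refl eq refl] by blast
qed

text \<open>
  Changing one coordinate keeps a point near \<open>w\<close> inside \<open>W\<close>, so partial derivatives at points of
  \<open>W\<close> depend only on the values in \<open>W\<close>, where the logarithms are controlled.
\<close>

lemma slice_of_open:
  assumes W: "openin (top_of_set (cspace n)) W" and w: "w \<in> W" and i: "i \<in> {1..n}"
  obtains S where "open S" and "w i \<in> S" and "\<And>s. s \<in> S \<Longrightarrow> w(i := s) \<in> W"
    and "continuous_on S (\<lambda>s. w(i := s))"
proof -
  obtain T where T: "open T" "W = cspace n \<inter> T"
    using W by (auto simp: openin_open)
  have cont: "continuous_on A (\<lambda>s. w(i := s))" for A
  proof (rule continuous_on_coordinatewise_then_product)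
    show "continuous_on A (\<lambda>s. (w(i := s)) j)" for j
      by (cases "j = i") auto
  qed
  show thesis
  proof
    show "open ((\<lambda>s. w(i := s)) -` T)"
      using T(1) cont by (rule open_vimage)
    show "w(i := s) \<in> W" if "s \<in> (\<lambda>s. w(i := s)) -` T" for s
      using that w i unfolding T(2) by (auto simp: cspace_def PiE_def extensional_def)
  qed (use w T cont in auto)
qed

lemma partial_power_log_sum:
  assumes br: "log_branches n k b W lg" and w: "w \<in> W" and i: "i \<in> {1..n}"
    and F: "\<And>x. x \<in> W \<Longrightarrow>
      F x = (\<Sum>J\<in>incr_idx n (k + 1). C J * (f_disc k b J x ^ p * (lg J x + h)))"
  shows "partial i F w = (\<Sum>J\<in>incr_idx n (k + 1). C J * (slope k b J i *
    (of_nat p * f_disc k b J w ^ (p - 1) * (lg J w + h) + f_disc k b J w ^ p / f_disc k b J w)))"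
proof -
  have W: "openin (top_of_set (cspace n)) W"
    using br by (simp add: log_branches_def)
  obtain S where S: "open S" "w i \<in> S" "\<And>s. s \<in> S \<Longrightarrow> w(i := s) \<in> W"
      "continuous_on S (\<lambda>s. w(i := s))"
    using slice_of_open[OF W w i] by blast
  let ?f = "\<lambda>J s. f_disc k b J (w(i := s))"
  let ?l = "\<lambda>J s. lg J (w(i := s))"
  have df: "(?f J has_field_derivative slope k b J i) (at (w i))" for J
    unfolding f_disc_upd by (auto intro!: derivative_eq_intros)
  have dl: "(?l J has_field_derivative slope k b J i / f_disc k b J w) (at (w i))"
    if J: "J \<in> incr_idx n (k + 1)" for J
  proof -
    have "continuous_on W (lg J)" and e: "\<And>x. x \<in> W \<Longrightarrow> exp (lg J x) = f_disc k b J x"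
      using br J by (auto simp: log_branches_def)
    moreover have "(\<lambda>s. w(i := s)) ` S \<subseteq> W"
      using S(3) by blast
    ultimately have "continuous_on S (?l J)"
      using S(4) continuous_on_compose2 by blast
    then have "isCont (?l J) (w i)"
      using S(1,2) by (simp add: continuous_on_eq_continuous_at)
    moreover have "\<forall>\<^sub>F s in nhds (w i). exp (?l J s) = ?f J s"
      unfolding eventually_nhds using S(1-3) e by blast
    ultimately show ?thesis
      using has_field_derivative_continuous_log[where g = "?l J" and f = "?f J" and s = "w i"] df
      by simp
  qed
  have "((\<lambda>s. C J * (?f J s ^ p * (?l J s + h))) has_field_derivative
      C J * (slope k b J i * (of_nat p * f_disc k b J w ^ (p - 1) * (lg J w + h) +
        f_disc k b J w ^ p / f_disc k b J w))) (at (w i))"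
    if J: "J \<in> incr_idx n (k + 1)" for J
    by (rule DERIV_cong[OF DERIV_cmult[OF DERIV_mult[OF DERIV_power[OF df]
          DERIV_add[OF dl[OF J] DERIV_const]]]])
      (simp add: algebra_simps)
  then have "((\<lambda>s. \<Sum>J\<in>incr_idx n (k + 1). C J * (?f J s ^ p * (?l J s + h))) has_field_derivative
      (\<Sum>J\<in>incr_idx n (k + 1). C J * (slope k b J i *
        (of_nat p * f_disc k b J w ^ (p - 1) * (lg J w + h) + f_disc k b J w ^ p / f_disc k b J w))))
      (at (w i))"
    by (rule DERIV_sum)
  moreover have ev: "\<forall>\<^sub>F s in nhds (w i). F (w(i := s)) =
      (\<Sum>J\<in>incr_idx n (k + 1). C J * (?f J s ^ p * (?l J s + h)))"
    unfolding eventually_nhds using S(1-3) F by blast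
  ultimately have "((\<lambda>s. F (w(i := s))) has_field_derivative
      (\<Sum>J\<in>incr_idx n (k + 1). C J * (slope k b J i *
        (of_nat p * f_disc k b J w ^ (p - 1) * (lg J w + h) + f_disc k b J w ^ p / f_disc k b J w))))
      (at (w i))"
    by (simp only: DERIV_cong_ev[OF refl ev refl])
  then show ?thesis
    unfolding partial_def by (rule DERIV_imp_deriv)
qed

text \<open>
  Each derivative of \<open>f\<^sup>p (log f + h)\<close> lowers \<open>p\<close> and shifts \<open>h\<close> by \<open>1/p\<close>.  The harmonic sum that
  accumulates in \<open>h\<close> is left unspecified, since the derivative that removes the logarithm removes
  it as well.
\<close>

lemma iter_partial_power_log_sum:
  assumes br: "log_branches n k b W lg"
    and F: "\<And>x. x \<in> W \<Longrightarrow>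
      F x = (\<Sum>J\<in>incr_idx n (k + 1). C J * (f_disc k b J x ^ q * lg J x))"
    and "set ms \<subseteq> {1..n}" and "length ms \<le> q"
  shows "\<exists>h. \<forall>w\<in>W. iter_partial ms F w = (\<Sum>J\<in>incr_idx n (k + 1).
    (C J * prod_list (map (slope k b J) ms) * (fact q / fact (q - length ms))) *
    (f_disc k b J w ^ (q - length ms) * (lg J w + h)))"
  using assms(3,4)
proof (induction ms)
  case Nil
  then show ?case
    using F by (intro exI[of _ 0]) (simp add: iter_partial_def)
next
  case (Cons i ms)
  define p where "p = q - length (i # ms)"
  have p: "q - length ms = Suc p"
    using Cons.prems by (simp add: p_def)
  from Cons obtain h where h: "\<And>w. w \<in> W \<Longrightarrow> iter_partial ms F w =
      (\<Sum>J\<in>incr_idx n (k + 1).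
        (C J * prod_list (map (slope k b J) ms) * (fact q / fact (Suc p))) *
        (f_disc k b J w ^ Suc p * (lg J w + h)))"
    unfolding p by auto
  show ?case
    unfolding p_def[symmetric]
  proof (intro exI ballI)
    fix w assume w: "w \<in> W"
    have "iter_partial (i # ms) F w = partial i (iter_partial ms F) w"
      by (simp add: iter_partial_def)
    also have "\<dots> = (\<Sum>J\<in>incr_idx n (k + 1).
        (C J * prod_list (map (slope k b J) ms) * (fact q / fact (Suc p))) * (slope k b J i *
        (of_nat (Suc p) * f_disc k b J w ^ (Suc p - 1) * (lg J w + h) +
         f_disc k b J w ^ Suc p / f_disc k b J w)))"
      using Cons.prems by (intro partial_power_log_sum[OF br w] h) auto
    also have "\<dots> = (\<Sum>J\<in>incr_idx n (k + 1).
        (C J * prod_list (map (slope k b J) (i # ms)) * (fact q / fact p)) *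
        (f_disc k b J w ^ p * (lg J w + (h + 1 / of_nat (Suc p)))))"
    proof (rule sum.cong)
      fix J assume "J \<in> incr_idx n (k + 1)"
      then have "exp (lg J w) = f_disc k b J w"
        using br w by (auto simp: log_branches_def)
      then have nz: "f_disc k b J w \<noteq> 0"
        by (metis exp_not_eq_zero)
      \<comment> \<open>the step of the harmonic sum, with \<open>P = p + 1\<close>, \<open>v = p!\<close> and \<open>y = f\<^sup>p\<close>\<close>
      have *: "(A * R * (u / (P * v))) * (s * (P * y * (l + h) + y)) =
          (A * (s * R) * (u / v)) * (y * (l + (h + 1 / P)))"
        if "P \<noteq> 0" "v \<noteq> 0" for A R u P v s y l :: complex
        using that by (simp add: field_simps)
      have "(of_nat (Suc p) :: complex) \<noteq> 0"
        by (simp only: of_nat_eq_0_iff)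
      from *[OF this fact_nonzero] nz
      show "(C J * prod_list (map (slope k b J) ms) * (fact q / fact (Suc p))) * (slope k b J i *
        (of_nat (Suc p) * f_disc k b J w ^ (Suc p - 1) * (lg J w + h) +
         f_disc k b J w ^ Suc p / f_disc k b J w)) =
        (C J * prod_list (map (slope k b J) (i # ms)) * (fact q / fact p)) *
        (f_disc k b J w ^ p * (lg J w + (h + 1 / of_nat (Suc p))))"
        by (simp add: fact_Suc del: of_nat_Suc)
    qed simp
    finally show "iter_partial (i # ms) F w = (\<Sum>J\<in>incr_idx n (k + 1).
        (C J * prod_list (map (slope k b J) (i # ms)) * (fact q / fact p)) *
        (f_disc k b J w ^ p * (lg J w + (h + 1 / of_nat (Suc p)))))" .
  qed
qed

lemma iter_partial_power_log_sum_top: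
  assumes br: "log_branches n k b W lg" and w: "w \<in> W" and i: "i \<in> {1..n}"
    and F: "\<And>x. x \<in> W \<Longrightarrow>
      F x = (\<Sum>J\<in>incr_idx n (k + 1). C J * (f_disc k b J x ^ q * lg J x))"
    and ms: "set ms \<subseteq> {1..n}" "length ms = q"
  shows "iter_partial (i # ms) F w = (\<Sum>J\<in>incr_idx n (k + 1).
    C J * fact q * prod_list (map (slope k b J) (i # ms)) / f_disc k b J w)"
proof -
  obtain h where h: "\<And>x. x \<in> W \<Longrightarrow> iter_partial ms F x = (\<Sum>J\<in>incr_idx n (k + 1).
      (C J * prod_list (map (slope k b J) ms) * fact q) *
      (f_disc k b J x ^ 0 * (lg J x + h)))"
    using iter_partial_power_log_sum[OF br F ms(1)] ms(2) by auto
  have "iter_partial (i # ms) F w = partial i (iter_partial ms F) w"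
    by (simp add: iter_partial_def)
  also have "\<dots> = (\<Sum>J\<in>incr_idx n (k + 1).
      C J * fact q * prod_list (map (slope k b J) (i # ms)) / f_disc k b J w)"
    using partial_power_log_sum[OF br w i h] by (simp add: algebra_simps)
  finally show ?thesis .
qed

section \<open>Comparison of the two sides\<close>

text \<open>
  The contribution of a \<open>k + 1\<close>-element set to either side, written so that the order of the
  entries of \<open>J\<close> visibly matters only through signs.
\<close>

definition contribution :: "nat \<Rightarrow> (nat \<Rightarrow> nat \<Rightarrow> complex) \<Rightarrow> (nat \<Rightarrow> complex) \<Rightarrow>
    (nat \<Rightarrow> complex) \<Rightarrow> nat list \<Rightarrow> nat list \<Rightarrow> complex" where
  "contribution k b a z ms J = (\<Prod>x\<in>set J. a x) * prod_list (map (slope k b J) ms) /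
     (f_disc k b J z * (\<Prod>x\<in>set J. slope k b J x)\<^sup>2)"

lemma prod_list_map_mult_const:
  "prod_list (map (\<lambda>x. e * g x) xs) = (e :: complex) ^ length xs * prod_list (map g xs)"
  by (induction xs) (auto simp: algebra_simps)

text \<open>
  Reordering \<open>J\<close> multiplies \<open>f\<^sub>J\<close> and each slope by the sign of \<open>J\<close>.  The sign enters an odd number
  of times in the numerator, once through \<open>f\<^sub>J\<close>, and squared otherwise.
\<close>

lemma contribution_sort:
  assumes "distinct J" and "length J = k + 1" and "odd (length ms)"
  shows "contribution k b a z ms (sort J) = contribution k b a z ms J"
proof -
  let ?e = "idx_sign J"
  have e: "?e = 1 \<or> ?e = -1"
    using idx_sign_square[OF assms(1)] by (simp add: square_eq_1_iff)
  have sl: "slope k b J = (\<lambda>i. ?e * slope k b (sort J) i)"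
    using slope_sort[OF assms(2)] by blast
  have "contribution k b a z ms J = (\<Prod>x\<in>set J. a x) *
      (?e ^ length ms * prod_list (map (slope k b (sort J)) ms)) /
      (?e * f_disc k b (sort J) z * (?e ^ card (set J) * (\<Prod>x\<in>set J. slope k b (sort J) x))\<^sup>2)"
    unfolding contribution_def
    by (simp only: sl f_disc_sort[OF assms(2)] prod_list_map_mult_const prod.distrib prod_constant)
  also have "\<dots> = contribution k b a z ms (sort J)"
    using e assms(3) by (auto simp: contribution_def power_mult_distrib simp flip: power_mult)
  finally show ?thesis by simp
qed

lemma prod_list_map_nth:
  "length M = r \<Longrightarrow> prod_list (map g M) = (\<Prod>l<r. (g (M ! l) :: complex))"
  by (simp add: prod.list_conv_set_nth atLeast0LessThan)

lemma sum_insert_index: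
  assumes "m \<in> {1..n}" and "\<And>J. J \<in> incr_idx n (k + 1) \<Longrightarrow> m \<notin> set J \<Longrightarrow> g J = 0"
  shows "(\<Sum>I\<in>{I \<in> incr_idx n k. m \<notin> set I}. g (sort (m # I))) =
    (\<Sum>J\<in>incr_idx n (k + 1). g J :: complex)"
proof -
  have "(\<Sum>I\<in>{I \<in> incr_idx n k. m \<notin> set I}. g (sort (m # I))) =
      (\<Sum>J\<in>{J \<in> incr_idx n (k + 1). m \<in> set J}. g J)"
  proof (rule sum.reindex_bij_witness[of _ "remove1 m" "\<lambda>I. sort (m # I)"])
    fix I assume "I \<in> {I \<in> incr_idx n k. m \<notin> set I}"
    then have I: "distinct I" "sorted I" "length I = k" "set I \<subseteq> {1..n}" "m \<notin> set I"
      by (auto simp: incr_idx_def strict_sorted_iff)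
    then show "remove1 m (sort (m # I)) = I"
      by (simp add: remove1_insort_key sorted_sort_id)
    show "sort (m # I) \<in> {J \<in> incr_idx n (k + 1). m \<in> set J}"
      using I assms(1) by (auto intro!: sort_in_incr_idx simp del: sort_key_simps)
  next
    fix J assume "J \<in> {J \<in> incr_idx n (k + 1). m \<in> set J}"
    then have J: "distinct J" "sorted J" "length J = k + 1" "set J \<subseteq> {1..n}" "m \<in> set J"
      by (auto simp: incr_idx_def strict_sorted_iff)
    then have s: "sort (remove1 m J) = remove1 m J"
      by (simp add: sorted_sort_id sorted_remove1)
    then show "sort (m # remove1 m J) = J"
      using J by (simp add: insort_remove1)
    show "remove1 m J \<in> {I \<in> incr_idx n k. m \<notin> set I}"
      using J by (auto simp: incr_idx_def strict_sorted_iff sorted_remove1 length_remove1)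
  qed simp
  also have "\<dots> = (\<Sum>J\<in>incr_idx n (k + 1). g J)"
    using assms(2) finite_incr_idx by (intro sum.mono_neutral_left) auto
  finally show ?thesis .
qed

text \<open>
  With \<open>m\<^sub>0\<close> listed first, the minor \<open>d\<^sub>I\<close> in the definition of \<open>K\<close> is the slope of \<open>f\<^sub>J\<close> at \<open>m\<^sub>0\<close>.
  The sets \<open>J\<close> that avoid \<open>m\<^sub>0\<close> can be added to the sum because this slope vanishes for them.
\<close>

lemma S_form_K_op:
  assumes m0: "m0 \<in> {1..n}" and M: "length M = k" and M': "length M' = k"
    and nz: "\<And>I. length I = k \<Longrightarrow> distinct I \<Longrightarrow> set I \<subseteq> {1..n} \<Longrightarrow> d_minor k b I \<noteq> 0"
  shows "S_form n k a (K_op n k b a m0 z (v_vec n k a M)) (v_vec n k a M') =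
    d_minor k b M * d_minor k b M' *
    (\<Sum>J\<in>incr_idx n (k + 1). contribution k b a z (m0 # M @ M') J)"
proof -
  let ?T = "contribution k b a z (m0 # M @ M')"
  let ?u = "v_vec n k a M" and ?v = "v_vec n k a M'"
  have "S_form n k a (K_op n k b a m0 z ?u) ?v =
      (\<Sum>I\<in>{I \<in> incr_idx n k. m0 \<notin> set I}. d_minor k b I / f_disc k b (m0 # I) z *
        S_form n k a (L_op k a (m0 # I) ?u) ?v)"
    unfolding K_op_def by (rule S_form_sum_left)
  also have "\<dots> = (\<Sum>I\<in>{I \<in> incr_idx n k. m0 \<notin> set I}.
      d_minor k b M * d_minor k b M' * ?T (sort (m0 # I)))"
  proof (rule sum.cong)
    fix I assume "I \<in> {I \<in> incr_idx n k. m0 \<notin> set I}"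
    then have I: "distinct I" "length I = k" "set I \<subseteq> {1..n}" "m0 \<notin> set I"
      by (auto simp: incr_idx_def strict_sorted_iff)
    define J where "J = m0 # I"
    have J: "distinct J" "length J = k + 1" "set J \<subseteq> {1..n}"
      using I m0 by (auto simp: J_def)
    define Q where "Q = (\<Prod>x\<in>set J. slope k b J x)"
    have Q: "(\<Prod>l<k + 1. slope k b J (J ! l)) = Q"
      unfolding Q_def by (rule prod_nth_set[OF J(1,2)])
    have "slope k b J x \<noteq> 0" if x: "x \<in> set J" for x
    proof -
      obtain l where l: "l < k + 1" "x = J ! l"
        using x J(2) by (metis in_set_conv_nth)
      have "d_minor k b (omit l J) \<noteq> 0"
        using l J set_omit[of l J] by (intro nz) (auto simp: length_omit)
      then show ?thesis using l J by (simp add: slope_nth)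
    qed
    then have Q0: "Q \<noteq> 0"
      by (simp add: Q_def)
    have u: "face_sum k J ?u = d_minor k b M * prod_list (map (slope k b J) M) / Q"
      using face_sum_v_vec_mult[OF J M nz, of a] Q0
      unfolding Q prod_list_map_nth[OF M] by (simp add: field_simps)
    have v: "face_sum k J ?v = d_minor k b M' * prod_list (map (slope k b J) M') / Q"
      using face_sum_v_vec_mult[OF J M' nz, of a] Q0
      unfolding Q prod_list_map_nth[OF M'] by (simp add: field_simps)
    have "slope k b J m0 = d_minor k b I"
      using slope_nth[OF J(1,2), of 0 b] by (simp add: J_def omit_def)
    then have "d_minor k b I / f_disc k b J z * S_form n k a (L_op k a J ?u) ?v =
        d_minor k b M * d_minor k b M' * ?T J"
      unfolding S_form_L_op[OF J] u v contribution_def Q_def[symmetric]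
      by (simp add: power2_eq_square)
    moreover have "?T (sort J) = ?T J"
      using M M' by (intro contribution_sort[OF J(1,2)]) simp
    ultimately show "d_minor k b I / f_disc k b (m0 # I) z * S_form n k a (L_op k a (m0 # I) ?u) ?v =
        d_minor k b M * d_minor k b M' * ?T (sort (m0 # I))"
      by (simp add: J_def del: sort_key_simps)
  qed simp
  also have "\<dots> = d_minor k b M * d_minor k b M' *
      (\<Sum>I\<in>{I \<in> incr_idx n k. m0 \<notin> set I}. ?T (sort (m0 # I)))"
    by (simp only: sum_distrib_left)
  also have "(\<Sum>I\<in>{I \<in> incr_idx n k. m0 \<notin> set I}. ?T (sort (m0 # I))) =
      (\<Sum>J\<in>incr_idx n (k + 1). ?T J)"
    using slope_eq_0 by (intro sum_insert_index[OF m0]) (auto simp: contribution_def incr_idx_def)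
  finally show ?thesis .
qed

lemma iter_partial_P_tilde:
  assumes br: "log_branches n k b W lg" and z: "z \<in> W" and m0: "m0 \<in> {1..n}"
    and ms: "set ms \<subseteq> {1..n}" "length ms = 2 * k"
  shows "iter_partial (m0 # ms) (P_tilde n k b a c lg) z =
    c\<^sup>2 * (\<Sum>J\<in>incr_idx n (k + 1). contribution k b a z (m0 # ms) J)"
proof -
  define C where "C = (\<lambda>J. c\<^sup>2 / fact (2 * k) *
    ((\<Prod>l<k+1. a (J ! l)) / (\<Prod>l<k+1. (d_minor k b (omit l J))\<^sup>2)))"
  have "iter_partial (m0 # ms) (P_tilde n k b a c lg) z = (\<Sum>J\<in>incr_idx n (k + 1).
      C J * fact (2 * k) * prod_list (map (slope k b J) (m0 # ms)) / f_disc k b J z)"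
    by (rule iter_partial_power_log_sum_top[OF br z m0 _ ms])
      (simp add: P_tilde_def C_def sum_distrib_left mult.assoc)
  also have "\<dots> = (\<Sum>J\<in>incr_idx n (k + 1). c\<^sup>2 * contribution k b a z (m0 # ms) J)"
  proof (rule sum.cong)
    fix J assume "J \<in> incr_idx n (k + 1)"
    then have J: "distinct J" "length J = k + 1"
      by (auto simp: incr_idx_def strict_sorted_iff)
    have "(\<Prod>x\<in>set J. slope k b J x)\<^sup>2 = (\<Prod>l<k+1. (slope k b J (J ! l))\<^sup>2)"
      by (simp only: prod_nth_set[OF J, of "slope k b J", symmetric] prod_power_distrib)
    also have "\<dots> = (\<Prod>l<k+1. (d_minor k b (omit l J))\<^sup>2)"
      using J by (intro prod.cong) (auto simp: slope_nth power_mult_distrib simp flip: power_mult)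
    finally have "(\<Prod>x\<in>set J. slope k b J x)\<^sup>2 = (\<Prod>l<k+1. (d_minor k b (omit l J))\<^sup>2)" .
    then show "C J * fact (2 * k) * prod_list (map (slope k b J) (m0 # ms)) / f_disc k b J z =
        c\<^sup>2 * contribution k b a z (m0 # ms) J"
      unfolding C_def contribution_def prod_nth_set[OF J, of a] by (simp add: mult_ac)
  qed simp
  finally show ?thesis by (simp only: sum_distrib_left)
qed

theorem corollary6p21:
  fixes n k :: nat
    and b :: "nat \<Rightarrow> nat \<Rightarrow> complex"
    and a :: "nat \<Rightarrow> complex"
    and c :: complex
    and z :: "nat \<Rightarrow> complex"
    and W :: "(nat \<Rightarrow> complex) set"
    and lg :: "nat list \<Rightarrow> (nat \<Rightarrow> complex) \<Rightarrow> complex"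
    and m0 :: nat
    and M M' :: "nat list"
  assumes "1 \<le> k" and "k < n"
    and "\<And>I. length I = k \<Longrightarrow> distinct I \<Longrightarrow> set I \<subseteq> {1..n} \<Longrightarrow> d_minor k b I \<noteq> 0"
    and "\<And>j. j \<in> {1..n} \<Longrightarrow> a j \<noteq> 0"
    and "(\<Sum>j=1..n. a j) \<noteq> 0"
    and "is_normalizing_const n k b a c"
    and "z \<in> cspace n - discriminant n k b"
    and "log_branches n k b W lg" and "z \<in> W"
    and "m0 \<in> {1..n}"
    and "length M = k" and "distinct M" and "set M \<subseteq> {1..n}"
    and "length M' = k" and "distinct M'" and "set M' \<subseteq> {1..n}"
  shows "c\<^sup>2 * S_form n k a (K_op n k b a m0 z (v_vec n k a M)) (v_vec n k a M') =
    d_minor k b M * d_minor k b M' * iter_partial (m0 # M @ M') (P_tilde n k b a c lg) z"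
proof -
  have "iter_partial (m0 # M @ M') (P_tilde n k b a c lg) z =
      c\<^sup>2 * (\<Sum>J\<in>incr_idx n (k + 1). contribution k b a z (m0 # M @ M') J)"
    using assms by (intro iter_partial_P_tilde) auto
  moreover have "S_form n k a (K_op n k b a m0 z (v_vec n k a M)) (v_vec n k a M') =
      d_minor k b M * d_minor k b M' *
      (\<Sum>J\<in>incr_idx n (k + 1). contribution k b a z (m0 # M @ M') J)"
    by (rule S_form_K_op) (use assms in auto)
  ultimately show ?thesis by simp
qed

end
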